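(* For every positive integer $d$ there exists $v(d)>0$, and for every integer $p\ge d+1$ there exists an integer $r=r(p,d)$, such that the following holds. Let $\mathcal{F}$ be a finite family of convex sets in $\mathbb{R}^d$, each of diameter at least $1$, such that among any $p$ members of $\mathcal{F}$ there exist $d+1$ whose intersection has diameter at least $1$. Then there exists a family $\mathcal{C}$ of $r$ convex sets, each of diameter at least $v(d)$, such that every member of $\mathcal{F}$ contains at least one element of $\mathcal{C}$.
   Context: Diameter is with respect to the Euclidean metric. *)

theory Defs
  imports "HOL-Analysis.Analysis"
begin

text \<open>Euclidean diameter with values in the extended reals, so that unbounded
  convex sets get diameter infinity (the library's real-valued diameter is
  unspecified for unbounded sets). The empty set gets diameter minus infinity.\<close>
definition ediam :: "'a::metric_space set \<Rightarrow> ereal" where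
  "ediam S = Sup {ereal (dist x y) | x y. x \<in> S \<and> y \<in> S}"

end

theory Submission
  imports Defs "HOL-Library.Ramsey"
begin

text \<open>Let \<open>d = CARD('n)\<close>. A set of diameter at least 1 has extent at least \<open>1 / (2d)\<close> in some
  coordinate direction \<open>i\<close>. For a convex \<open>K\<close> the pairs \<open>(x, y)\<close> in \<open>K \<times> K\<close> with
  \<open>y $ i - x $ i \<ge> 1 / (4d)\<close> form a convex set \<open>L i K\<close> in dimension \<open>2d\<close>, and a common point of
  such sets is a common segment. Ramsey's theorem and Helly's theorem on hyperplanes
  \<open>x $ i = const\<close> turn the hypothesis on \<open>(d + 1)\<close>-tuples into the following: among sufficiently
  many sets, some \<open>2d + 1\<close> have intersecting lifts \<open>L i K\<close> for some \<open>i\<close>. From there on the argument is that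
  of Alon and Kleitman: a weighted fractional Helly theorem gives a point hitting a positive
  fraction of the lifts for any weights, hence (by duality) a multiset of points of which
  each \<open>K\<close> is hit by a positive fraction, and a weak epsilon-net replaces this multiset by boundedly many
  points. Both fractional Helly and the selection lemma behind weak nets come from one
  averaging principle: the point of an intersection of \<open>D + 1\<close> sets closest to the origin
  depends on only \<open>D\<close> of them, so the remaining one can be resampled.\<close>

subsection \<open>Helly-type theorems\<close>

text \<open>\<open>Helly\<close> counts distinct sets, while an indexed family may repeat them. If
  there are fewer than \<open>DIM('a) + 1\<close> distinct members, some \<open>DIM('a) + 1\<close>
  indices already realise all of them, and \<open>meet\<close> for these indices is the
  claim.\<close>

lemma Helly_indexed:
  fixes X :: "'i \<Rightarrow> 'a::euclidean_space set"
  assumes fin: "finite I" and card: "DIM('a) + 1 \<le> card I"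
    and conv: "\<And>i. i \<in> I \<Longrightarrow> convex (X i)"
    and meet: "\<And>J. J \<subseteq> I \<Longrightarrow> card J = DIM('a) + 1 \<Longrightarrow> (\<Inter>i\<in>J. X i) \<noteq> {}"
  shows "(\<Inter>i\<in>I. X i) \<noteq> {}"
proof (cases "DIM('a) + 1 \<le> card (X ` I)")
  case True
  show ?thesis
  proof (rule Helly[OF True])
    show "\<forall>s\<in>X ` I. convex s" using conv by auto
    fix T assume T: "T \<subseteq> X ` I" "card T = DIM('a) + 1"
    then obtain J where J: "J \<subseteq> I" "inj_on X J" "T = X ` J"
      by (meson subset_image_inj)
    then show "\<Inter>T \<noteq> {}"
      using meet[of J] T(2) by (simp add: card_image)
  qed
next
  case False
  obtain J where J: "J \<subseteq> I" "inj_on X J" "X ` I = X ` J"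
    by (meson subset_image_inj subset_refl)
  then have "card J \<le> DIM('a) + 1"
    using False by (simp add: card_image)
  then obtain J' where J': "J \<subseteq> J'" "J' \<subseteq> I" "card J' = DIM('a) + 1"
    using exists_subset_between[of J "DIM('a) + 1" I] J(1) card fin by auto
  have "X ` I = X ` J'"
    using image_mono[OF J'(1), of X] image_mono[OF J'(2), of X] J(3) by (metis subset_antisym)
  then show ?thesis using meet[OF J'(2,3)] by simp
qed

text \<open>\<open>C\<close> is adjoined under the extra index \<open>None\<close>: a subfamily of
  \<open>DIM('a) + 1\<close> sets either consists of \<open>C\<close> and \<open>DIM('a)\<close>
  others (\<open>meetC\<close>) or avoids \<open>C\<close> (\<open>meet\<close>).\<close>

lemma Helly_relative:
  fixes X :: "'i \<Rightarrow> 'a::euclidean_space set"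
  assumes fin: "finite I" and card: "DIM('a) \<le> card I"
    and conv: "\<And>i. i \<in> I \<Longrightarrow> convex (X i)" and C: "convex C"
    and meet: "\<And>J. J \<subseteq> I \<Longrightarrow> card J = DIM('a) + 1 \<Longrightarrow> (\<Inter>i\<in>J. X i) \<noteq> {}"
    and meetC: "\<And>J. J \<subseteq> I \<Longrightarrow> card J = DIM('a) \<Longrightarrow> C \<inter> (\<Inter>i\<in>J. X i) \<noteq> {}"
  shows "C \<inter> (\<Inter>i\<in>I. X i) \<noteq> {}"
proof -
  define Y where "Y = case_option C X"
  define K where "K = insert None (Some ` I)"
  have "(\<Inter>k\<in>K. Y k) \<noteq> {}"
  proof (rule Helly_indexed)
    show "finite K" using fin by (simp add: K_def)
    have "card K = Suc (card I)"
      using fin by (simp add: K_def card_image card_insert_if image_iff)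
    then show "DIM('a) + 1 \<le> card K" using card by simp
    show "convex (Y k)" if "k \<in> K" for k using that conv C by (auto simp: K_def Y_def)
    fix J assume J: "J \<subseteq> K" "card J = DIM('a) + 1"
    define J' where "J' = {i. Some i \<in> J}"
    have J'I: "J' \<subseteq> I" using J by (auto simp: K_def J'_def)
    have finJ: "finite J'" using J'I fin finite_subset by blast
    show "(\<Inter>k\<in>J. Y k) \<noteq> {}"
    proof (cases "None \<in> J")
      case True
      have eq: "J = insert None (Some ` J')"
        using True by (auto simp: J'_def image_iff) (metis not_None_eq)
      have "card J' = DIM('a)"
        using J(2) finJ unfolding eq by (simp add: card_image card_insert_if image_iff)
      then have "C \<inter> (\<Inter>i\<in>J'. X i) \<noteq> {}" using meetC[OF J'I] by blast
      then show ?thesis unfolding eq by (simp add: Y_def)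
    next
      case False
      have eq: "J = Some ` J'"
        using False by (auto simp: J'_def image_iff) (metis not_None_eq)
      have "card J' = DIM('a) + 1"
        using J(2) unfolding eq by (simp add: card_image)
      then show ?thesis using meet[OF J'I] unfolding eq by (simp add: Y_def)
    qed
  qed
  then show ?thesis by (simp add: K_def Y_def)
qed

text \<open>Helly's theorem is applied to the sets and the open ball around the origin that just misses
  their intersection.\<close>
lemma closest_point_of_subfamily:
  fixes X :: "'i \<Rightarrow> 'a::euclidean_space set"
  assumes card: "card S = DIM('a) + 1"
    and conv: "\<And>s. s \<in> S \<Longrightarrow> convex (X s)" and cl: "\<And>s. s \<in> S \<Longrightarrow> closed (X s)"
    and ne: "(\<Inter>s\<in>S. X s) \<noteq> {}"
  shows "\<exists>j\<in>S. closest_point (\<Inter>s\<in>S - {j}. X s) 0 \<in> X j"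
proof -
  define c where "c = closest_point (\<Inter>s\<in>S. X s) 0"
  have fin: "finite S" using card by (simp add: card_ge_0_finite)
  have clS: "closed (\<Inter>s\<in>S. X s)" using cl by blast
  have cin: "c \<in> (\<Inter>s\<in>S. X s)" unfolding c_def using closest_point_in_set[OF clS ne] .
  have "ball 0 (norm c) \<inter> (\<Inter>s\<in>S. X s) = {}"
    using closest_point_le[OF clS, of _ 0] unfolding c_def by (fastforce simp: dist_norm)
  moreover have "(\<Inter>s\<in>J. X s) \<noteq> {}" if "J \<subseteq> S" for J
    using ne that by blast
  \<comment> \<open>Contrapositive of \<open>Helly_relative\<close>: its conclusion fails and
    \<open>meet\<close> holds, so \<open>meetC\<close> fails for some \<open>J\<close>.\<close>
  ultimately obtain J where J: "J \<subseteq> S" "card J = DIM('a)" "ball 0 (norm c) \<inter> (\<Inter>s\<in>J. X s) = {}"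
    using Helly_relative[of S X "ball 0 (norm c)"] fin card conv by auto
  have "card (S - J) = 1"
    using J card fin by (simp add: card_Diff_subset finite_subset[OF J(1)])
  then obtain j where j: "S - J = {j}" by (auto simp: card_1_singleton_iff)
  then have JS: "J = S - {j}" and jS: "j \<in> S" using J(1) by auto
  \<comment> \<open>\<open>c\<close> lies in the larger intersection over \<open>J\<close>, which
    still misses the open ball of radius \<open>norm c\<close>, so \<open>c\<close> is its closest
    point too.\<close>
  have "c = closest_point (\<Inter>s\<in>J. X s) 0"
  proof (rule closest_point_unique)
    show "convex (\<Inter>s\<in>J. X s)" using conv J(1) by (intro convex_INT) auto
    show "closed (\<Inter>s\<in>J. X s)" using cl J(1) by blast
    show "c \<in> (\<Inter>s\<in>J. X s)" using cin J(1) by auto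
    show "\<forall>z\<in>\<Inter>s\<in>J. X s. dist 0 c \<le> dist 0 z"
    proof
      fix z assume "z \<in> (\<Inter>s\<in>J. X s)"
      then have "z \<notin> ball 0 (norm c)" using J(3) by blast
      then show "dist 0 c \<le> dist 0 z" by (simp add: dist_norm)
    qed
  qed
  then show ?thesis using jS JS cin by auto
qed

text \<open>Resampling the coordinates in \<open>J a\<close> preserves the product measure, so the most likely
  label \<open>a\<close> survives, on average, a resampling with the other coordinates fixed.\<close>
lemma resampling:
  fixes m :: "'b \<Rightarrow> real"
  assumes finF: "finite F" and finP: "finite P" and finA: "finite A"
    and m0: "\<And>x. x \<in> F \<Longrightarrow> 0 \<le> m x" and m1: "sum m F = 1"
    and Q: "\<And>f. f \<in> P \<rightarrow>\<^sub>E F \<Longrightarrow> \<exists>a\<in>A. Q a f"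
  defines "\<mu> \<equiv> \<lambda>f. \<Prod>p\<in>P. m (f p)"
  shows "\<exists>a\<in>A. \<exists>f\<in>P \<rightarrow>\<^sub>E F.
    1 / card A \<le> (\<Sum>g\<in>P \<rightarrow>\<^sub>E F. \<mu> g * of_bool (Q a (override_on f g (J a))))"
proof -
  let ?E = "P \<rightarrow>\<^sub>E F"
  have finE: "finite ?E" using finF finP by (simp add: finite_PiE)
  have mu0: "0 \<le> \<mu> f" if "f \<in> ?E" for f
    unfolding \<mu>_def using that m0 by (intro prod_nonneg) (auto dest: PiE_mem)
  have mu1: "sum \<mu> ?E = 1"
    unfolding \<mu>_def using prod_sum_PiE[OF finP, of "\<lambda>_. F" "\<lambda>_. m"] finF m1 by simp
  define W where "W a = (\<Sum>f\<in>?E. \<mu> f * of_bool (Q a f))" for a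
  have Ane: "A \<noteq> {}"
    using Q mu1 by (metis (no_types, lifting) empty_iff ex_in_conv sum.empty zero_neq_one)
  \<comment> \<open>Every \<open>f\<close> satisfies \<open>Q\<close> for some label, so the
    expected number of such labels is at least 1 and some label has probability at least
    \<open>1 / card A\<close>.\<close>
  have "1 \<le> (\<Sum>a\<in>A. W a)"
  proof -
    have "1 = (\<Sum>f\<in>?E. \<mu> f)" using mu1 by simp
    also have "\<dots> \<le> (\<Sum>f\<in>?E. \<mu> f * (\<Sum>a\<in>A. of_bool (Q a f)))"
    proof (rule sum_mono)
      fix f assume f: "f \<in> ?E"
      then obtain a where a: "a \<in> A" "Q a f" using Q by blast
      have "(1::real) \<le> (\<Sum>a\<in>A. of_bool (Q a f))"
        using member_le_sum[of a A "\<lambda>a. of_bool (Q a f) :: real"] a finA by simp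
      then show "\<mu> f \<le> \<mu> f * (\<Sum>a\<in>A. of_bool (Q a f))"
        using mult_left_mono[OF _ mu0[OF f]] by fastforce
    qed
    also have "\<dots> = (\<Sum>a\<in>A. W a)"
      unfolding W_def sum_distrib_left by (rule sum.swap)
    finally show ?thesis .
  qed
  then obtain a where a: "a \<in> A" "1 / card A \<le> W a"
  proof -
    have "\<exists>a\<in>A. 1 / card A \<le> W a"
    proof (rule ccontr)
      assume "\<not> ?thesis"
      then have "(\<Sum>a\<in>A. W a) < (\<Sum>a\<in>A. 1 / card A)"
        using finA Ane by (intro sum_strict_mono) auto
      then show False using \<open>1 \<le> _\<close> finA Ane by simp
    qed
    then show ?thesis using that by blast
  qed
  \<comment> \<open>\<open>h\<close> exchanges the \<open>J a\<close> coordinates of two independent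
    samples. It is a weight-preserving involution, so the resampled function is distributed like
    \<open>f\<close>.\<close>
  define h where "h = (\<lambda>(f::'a \<Rightarrow> 'b, g). (override_on f g (J a), override_on g f (J a)))"
  have hh: "h (h x) = x" for x by (cases x) (auto simp: h_def override_on_def fun_eq_iff)
  have hE: "h x \<in> ?E \<times> ?E" if "x \<in> ?E \<times> ?E" for x
    using that by (cases x) (auto simp: h_def override_on_def PiE_iff extensional_def)
  have muh: "\<mu> (fst (h x)) * \<mu> (snd (h x)) = \<mu> (fst x) * \<mu> (snd x)" for x
    unfolding \<mu>_def prod.distrib[symmetric]
    by (cases x) (auto simp: h_def override_on_def intro!: prod.cong)
  define w where "w f = (\<Sum>g\<in>?E. \<mu> g * of_bool (Q a (override_on f g (J a))))" for f
  have "W a = (\<Sum>f\<in>?E. (\<mu> f * of_bool (Q a f)) * (\<Sum>g\<in>?E. \<mu> g))"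
    using mu1 by (simp add: W_def)
  also have "\<dots> = (\<Sum>x\<in>?E \<times> ?E. \<mu> (fst x) * \<mu> (snd x) * of_bool (Q a (fst x)))"
    by (simp add: sum_distrib_left sum.cartesian_product case_prod_unfold mult_ac)
  also have "\<dots> = (\<Sum>x\<in>?E \<times> ?E. \<mu> (fst x) * \<mu> (snd x) * of_bool (Q a (fst (h x))))"
    by (rule sum.reindex_bij_witness[of _ h h]) (auto simp: hh hE muh)
  also have "\<dots> = (\<Sum>f\<in>?E. \<mu> f * w f)"
    by (simp add: w_def h_def sum_distrib_left sum.cartesian_product case_prod_unfold mult_ac)
  finally have Wa: "W a = (\<Sum>f\<in>?E. \<mu> f * w f)" .
  \<comment> \<open>\<open>W a\<close> is the mean of \<open>w\<close>, so some fixed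
    \<open>f\<close> is at least average.\<close>
  have "\<exists>f\<in>?E. 1 / card A \<le> w f"
  proof (rule ccontr)
    assume "\<not> ?thesis"
    then have lt: "w f < 1 / card A" if "f \<in> ?E" for f using that by force
    obtain f where f: "f \<in> ?E" "\<mu> f > 0"
      using mu1 mu0 by (metis (no_types, lifting) less_eq_real_def not_less sum_nonpos zero_less_one)
    have "(\<Sum>f\<in>?E. \<mu> f * w f) < (\<Sum>f\<in>?E. \<mu> f * (1 / card A))"
    proof (rule sum_strict_mono_ex1[OF finE])
      show "\<forall>g\<in>?E. \<mu> g * w g \<le> \<mu> g * (1 / card A)"
        using lt mu0 by (intro ballI mult_left_mono) (auto intro: less_imp_le)
      show "\<exists>g\<in>?E. \<mu> g * w g < \<mu> g * (1 / card A)"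
        using f lt[OF f(1)] by (intro bexI[of _ f] mult_strict_left_mono) auto
    qed
    also have "\<dots> = 1 / card A" using mu1 by (simp flip: sum_divide_distrib)
    finally show False using a Wa by simp
  qed
  then show ?thesis using a unfolding w_def by blast
qed

section \<open>Weighted fractional Helly theorem\<close>

text \<open>A label \<open>(i, S, j)\<close> records the index, the intersecting draws and the draw
  that is redundant for the closest point. Fixing all draws but the \<open>j\<close>-th fixes this
  point; the probability that the resampled set contains it is the weight of the sets containing it.
  \<open>card I * 2 ^ P * P\<close> counts the labels.\<close>

lemma fractional_Helly_closed:
  fixes L :: "'l \<Rightarrow> 'k \<Rightarrow> 'a::euclidean_space set"
  assumes finF: "finite F" and finI: "finite I"
    and m0: "\<And>K. K \<in> F \<Longrightarrow> 0 \<le> m K" and m1: "sum m F = 1"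
    and conv: "\<And>i K. i \<in> I \<Longrightarrow> K \<in> F \<Longrightarrow> convex (L i K)"
    and cl: "\<And>i K. i \<in> I \<Longrightarrow> K \<in> F \<Longrightarrow> closed (L i K)"
    and meet: "\<And>f. f \<in> {..<P} \<rightarrow>\<^sub>E F \<Longrightarrow>
      \<exists>i\<in>I. \<exists>S\<subseteq>{..<P}. card S = DIM('a) + 1 \<and> (\<Inter>s\<in>S. L i (f s)) \<noteq> {}"
  shows "\<exists>i\<in>I. \<exists>z. 1 / real (card I * 2 ^ P * P) \<le> (\<Sum>K\<in>F. m K * of_bool (z \<in> L i K))"
proof -
  define A where "A = I \<times> Pow {..<P} \<times> {..<P}"
  define Q where "Q = (\<lambda>(i, S, j) (f :: nat \<Rightarrow> 'k). closest_point (\<Inter>s\<in>S - {j}. L i (f s)) 0 \<in> L i (f j))"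
  define J where "J = (\<lambda>(i::'l, S::nat set, j::nat). {j})"
  have finA: "finite A" using finI by (simp add: A_def)
  have cardA: "card A = card I * 2 ^ P * P"
    by (simp add: A_def card_cartesian_product card_Pow)
  have QA: "\<exists>a\<in>A. Q a f" if f: "f \<in> {..<P} \<rightarrow>\<^sub>E F" for f
  proof -
    obtain i S where iS: "i \<in> I" "S \<subseteq> {..<P}" "card S = DIM('a) + 1" "(\<Inter>s\<in>S. L i (f s)) \<noteq> {}"
      using meet[OF f] by blast
    have "f s \<in> F" if "s \<in> S" for s using f iS(2) that by (auto dest: PiE_mem)
    then obtain j where "j \<in> S" "closest_point (\<Inter>s\<in>S - {j}. L i (f s)) 0 \<in> L i (f j)"
      using closest_point_of_subfamily[OF iS(3), of "\<lambda>s. L i (f s)"] conv cl iS by metis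
    then show ?thesis using iS by (intro bexI[of _ "(i, S, j)"]) (auto simp: A_def Q_def)
  qed
  from resampling[where J = J and Q = Q, OF finF finite_lessThan[of P] finA m0 m1 QA]
  obtain i S j f where ij: "i \<in> I" "j < P" and f: "f \<in> {..<P} \<rightarrow>\<^sub>E F"
    and le: "1 / real (card A) \<le> (\<Sum>g\<in>{..<P} \<rightarrow>\<^sub>E F. (\<Prod>p\<in>{..<P}. m (g p)) *
      of_bool (Q (i, S, j) (override_on f g (J (i, S, j)))))"
    unfolding A_def by auto
  define z where "z = closest_point (\<Inter>s\<in>S - {j}. L i (f s)) 0"
  have Qz: "Q (i, S, j) (override_on f g (J (i, S, j))) \<longleftrightarrow> z \<in> L i (g j)" for g
    by (simp add: Q_def J_def z_def cong: INF_cong_simp)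
  \<comment> \<open>Marginalisation to coordinate \<open>j\<close>: the other coordinates contribute
    the factor \<open>sum m F = 1\<close>.\<close>
  have "(\<Sum>g\<in>{..<P} \<rightarrow>\<^sub>E F. (\<Prod>p\<in>{..<P}. m (g p)) * of_bool (z \<in> L i (g j)))
     = (\<Sum>g\<in>{..<P} \<rightarrow>\<^sub>E F. \<Prod>p\<in>{..<P}. m (g p) * (if p = j then of_bool (z \<in> L i (g p)) else 1))"
    using ij(2) by (simp add: prod.distrib prod.delta')
  also have "\<dots> = (\<Prod>p\<in>{..<P}. \<Sum>K\<in>F. m K * (if p = j then of_bool (z \<in> L i K) else 1))"
    using finF by (simp add: prod_sum_PiE)
  also have "\<dots> = (\<Prod>p\<in>{..<P}. if p = j then (\<Sum>K\<in>F. m K * of_bool (z \<in> L i K)) else 1)"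
    using m1 by (intro prod.cong) auto
  also have "\<dots> = (\<Sum>K\<in>F. m K * of_bool (z \<in> L i K))"
    using ij(2) by (simp add: prod.delta')
  finally show ?thesis using le ij(1) unfolding Qz cardA by auto
qed

text \<open>Reduction to closed sets: each set is shrunk to the hull of finitely many points, one
  chosen in every nonempty intersection of a subfamily containing it. Nonempty intersections stay
  nonempty.\<close>

theorem fractional_Helly:
  fixes L :: "'l \<Rightarrow> 'k \<Rightarrow> 'a::euclidean_space set"
  assumes finF: "finite F" and finI: "finite I"
    and m0: "\<And>K. K \<in> F \<Longrightarrow> 0 \<le> m K" and m1: "sum m F = 1"
    and conv: "\<And>i K. i \<in> I \<Longrightarrow> K \<in> F \<Longrightarrow> convex (L i K)"
    and meet: "\<And>f. f \<in> {..<P} \<rightarrow>\<^sub>E F \<Longrightarrow>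
      \<exists>i\<in>I. \<exists>S\<subseteq>{..<P}. card S = DIM('a) + 1 \<and> (\<Inter>s\<in>S. L i (f s)) \<noteq> {}"
  shows "\<exists>i\<in>I. \<exists>z. 1 / real (card I * 2 ^ P * P) \<le> (\<Sum>K\<in>F. m K * of_bool (z \<in> L i K))"
proof -
  define pick where "pick i G = (SOME z. z \<in> (\<Inter>K\<in>G. L i K))" for i G
  define L' where "L' i K = convex hull (pick i ` {G. G \<subseteq> F \<and> K \<in> G \<and> (\<Inter>K\<in>G. L i K) \<noteq> {}})" for i K
  have pick: "pick i G \<in> L i K" if "(\<Inter>K\<in>G. L i K) \<noteq> {}" "K \<in> G" for i G K
    using that someI_ex[of "\<lambda>z. z \<in> (\<Inter>K\<in>G. L i K)"] unfolding pick_def by blast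
  have sub: "L' i K \<subseteq> L i K" if "i \<in> I" "K \<in> F" for i K
    unfolding L'_def using conv[OF that] pick by (intro hull_minimal) auto
  have "\<exists>i\<in>I. \<exists>z. 1 / real (card I * 2 ^ P * P) \<le> (\<Sum>K\<in>F. m K * of_bool (z \<in> L' i K))"
  proof (rule fractional_Helly_closed[OF finF finI m0 m1])
    show "convex (L' i K)" for i K by (simp add: L'_def)
    show "closed (L' i K)" for i K
      unfolding L'_def using finF
      by (intro compact_imp_closed finite_imp_compact_convex_hull) auto
    fix f assume f: "f \<in> {..<P} \<rightarrow>\<^sub>E F"
    then obtain i S where iS: "i \<in> I" "S \<subseteq> {..<P}" "card S = DIM('a) + 1" "(\<Inter>s\<in>S. L i (f s)) \<noteq> {}"
      using meet[OF f] by blast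
    have "f ` S \<subseteq> F" using f iS(2) by (auto dest: PiE_mem)
    then have "pick i (f ` S) \<in> L' i (f s)" if "s \<in> S" for s
      unfolding L'_def using iS(4) that by (intro hull_inc) auto
    then show "\<exists>i\<in>I. \<exists>S\<subseteq>{..<P}. card S = DIM('a) + 1 \<and> (\<Inter>s\<in>S. L' i (f s)) \<noteq> {}"
      using iS by blast
  qed auto
  then obtain i z where iz: "i \<in> I" "1 / real (card I * 2 ^ P * P) \<le> (\<Sum>K\<in>F. m K * of_bool (z \<in> L' i K))"
    by blast
  moreover have "(\<Sum>K\<in>F. m K * of_bool (z \<in> L' i K)) \<le> (\<Sum>K\<in>F. m K * of_bool (z \<in> L i K))"
    using m0 sub iz(1) by (intro sum_mono mult_left_mono) auto
  ultimately show ?thesis by (meson order.trans)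
qed

subsection \<open>Weak epsilon-nets\<close>

text \<open>Two indices with the same point give a partition at once; otherwise
  \<open>DIM('a) + 2\<close> distinct points are affinely dependent and
  \<open>Radon_partition\<close> applies.\<close>

lemma Radon_indexed:
  fixes x :: "'i \<Rightarrow> 'a::euclidean_space"
  assumes fin: "finite B" and card: "card B = DIM('a) + 2"
  shows "\<exists>B1\<subseteq>B. convex hull (x ` B1) \<inter> convex hull (x ` (B - B1)) \<noteq> {}"
proof (cases "inj_on x B")
  case True
  then have "affine_dependent (x ` B)"
    using fin card by (intro affine_dependent_biggerset) (auto simp: card_image)
  then obtain M N where MN: "M \<inter> N = {}" "M \<union> N = x ` B" "convex hull M \<inter> convex hull N \<noteq> {}"
    using Radon_partition[of "x ` B"] fin by auto
  define B1 where "B1 = {b\<in>B. x b \<in> M}"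
  have img: "\<exists>b\<in>B. v = x b" if "v \<in> M \<union> N" for v
    using that MN(2) by auto
  have "M \<subseteq> x ` B1" using img by (fastforce simp: B1_def)
  moreover have "N \<subseteq> x ` (B - B1)" using img MN(1) by (fastforce simp: B1_def)
  ultimately have "convex hull (x ` B1) \<inter> convex hull (x ` (B - B1)) \<noteq> {}"
    using MN(3) hull_mono[of M "x ` B1"] hull_mono[of N "x ` (B - B1)"] by blast
  then show ?thesis by (intro exI[of _ B1]) (auto simp: B1_def)
next
  case False
  then obtain b c where bc: "b \<in> B" "c \<in> B" "b \<noteq> c" "x b = x c" by (auto simp: inj_on_def)
  have "x b \<in> convex hull (x ` {b})" "x b \<in> convex hull (x ` (B - {b}))"
    using bc by (auto intro!: hull_inc)
  then show ?thesis using bc(1) by (intro exI[of _ "{b}"]) blast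
qed

text \<open>Far more points than in Tverberg's theorem, which allows iterating Radon's theorem:
  split into \<open>DIM('a) + 2\<close> blocks and apply Radon to the common points of the blocks.\<close>
lemma weak_Tverberg:
  fixes z :: "nat \<Rightarrow> 'a::euclidean_space"
  shows "\<exists>col y. (\<forall>p. col p < 2 ^ m) \<and>
    (\<forall>j<2 ^ m. y \<in> convex hull (z ` {p. p < (DIM('a) + 2) ^ m \<and> col p = (j::nat)}))"
proof (induction m arbitrary: z)
  case 0
  show ?case by (intro exI[of _ "\<lambda>_. 0"] exI[of _ "z 0"]) (auto intro: hull_inc)
next
  case (Suc m)
  define n where "n = (DIM('a) + 2) ^ m"
  have n0: "n > 0" by (simp add: n_def)
  \<comment> \<open>Position \<open>p\<close> has offset \<open>p mod n\<close> in block
    \<open>p div n\<close>; the induction hypothesis colours each block \<open>b\<close> and gives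
    its common point \<open>y b\<close>.\<close>
  have "\<forall>b. \<exists>col y. (\<forall>p. col p < 2 ^ m) \<and>
    (\<forall>j<2 ^ m. y \<in> convex hull ((\<lambda>q. z (b * n + q)) ` {q. q < n \<and> col q = (j::nat)}))"
    using Suc.IH unfolding n_def by blast
  then obtain col y where col: "\<And>b p. col b p < (2::nat) ^ m"
    and y: "\<And>b j. j < 2 ^ m \<Longrightarrow>
      y b \<in> convex hull ((\<lambda>q. z (b * n + q)) ` {q. q < n \<and> col b q = j})"
    by metis
  obtain B1 w where B1: "B1 \<subseteq> {..<DIM('a) + 2}" and w: "w \<in> convex hull (y ` B1)"
    "w \<in> convex hull (y ` ({..<DIM('a) + 2} - B1))"
    using Radon_indexed[of "{..<DIM('a) + 2}" y] by auto
  \<comment> \<open>The two sides of the Radon partition use disjoint palettes. The hull of a colour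
    class contains \<open>y b\<close> for all blocks \<open>b\<close> on its side, hence the Radon
    point \<open>w\<close>.\<close>
  define col' where "col' p = (if p div n \<in> B1 then col (p div n) (p mod n)
    else col (p div n) (p mod n) + 2 ^ m)" for p
  have hull: "convex hull (y ` B) \<subseteq> convex hull (z ` {p. p < (DIM('a) + 2) ^ Suc m \<and> col' p = k})"
    if B: "B \<subseteq> {..<DIM('a) + 2}" and j: "j < 2 ^ m"
      and k: "\<And>b q. b \<in> B \<Longrightarrow> q < n \<Longrightarrow> col b q = j \<Longrightarrow> col' (b * n + q) = k" for B j k
  proof (rule hull_minimal)
    show "y ` B \<subseteq> convex hull (z ` {p. p < (DIM('a) + 2) ^ Suc m \<and> col' p = k})"
    proof
      fix v assume "v \<in> y ` B"
      then obtain b where b: "b \<in> B" "v = y b" by blast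
      have "b * n + q < (DIM('a) + 2) ^ Suc m" if "q < n" for q
      proof -
        have "b * n + q < (b + 1) * n" using that by simp
        also have "\<dots> \<le> (DIM('a) + 2) * n" using B b by (intro mult_right_mono) auto
        finally show ?thesis by (simp add: n_def)
      qed
      then have "(\<lambda>q. z (b * n + q)) ` {q. q < n \<and> col b q = j}
        \<subseteq> z ` {p. p < (DIM('a) + 2) ^ Suc m \<and> col' p = k}"
        using k[OF b(1)] by blast
      then show "v \<in> convex hull (z ` {p. p < (DIM('a) + 2) ^ Suc m \<and> col' p = k})"
        using y[OF j, of b] hull_mono b(2) by blast
    qed
  qed auto
  have "w \<in> convex hull (z ` {p. p < (DIM('a) + 2) ^ Suc m \<and> col' p = j})" if j: "j < 2 ^ Suc m" for j
  proof (cases "j < 2 ^ m")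
    case True
    have "convex hull (y ` B1) \<subseteq> convex hull (z ` {p. p < (DIM('a) + 2) ^ Suc m \<and> col' p = j})"
      by (rule hull[OF B1 True]) (simp add: col'_def)
    then show ?thesis using w(1) by blast
  next
    case False
    then have "j - 2 ^ m < 2 ^ m" using j by simp
    have "convex hull (y ` ({..<DIM('a) + 2} - B1))
      \<subseteq> convex hull (z ` {p. p < (DIM('a) + 2) ^ Suc m \<and> col' p = j})"
      by (rule hull[OF _ \<open>j - 2 ^ m < 2 ^ m\<close>]) (use False in \<open>auto simp: col'_def\<close>)
    then show ?thesis using w(2) by blast
  qed
  moreover have "col' p < 2 ^ Suc m" for p
    using col[of "p div n" "p mod n"] by (auto simp: col'_def)
  ultimately show ?case by blast
qed

text \<open>Among \<open>M\<close> random points, \<open>weak_Tverberg\<close> finds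
  \<open>D + 1\<close> disjoint groups whose hulls intersect. The closest point of the intersection
  depends on \<open>D\<close> groups only, so by \<open>resampling\<close> the remaining group one
  fixed point lies in the hull of the new draws with probability at least
  \<open>1 / card A\<close>.\<close>

lemma selection:
  "\<exists>c::real. \<exists>M::nat. c > 0 \<and> (\<forall>(Y::nat set) (z :: nat \<Rightarrow> 'a::euclidean_space).
     finite Y \<and> Y \<noteq> {} \<longrightarrow> (\<exists>a. c * real (card Y) ^ M \<le>
       real (card {g \<in> {..<M} \<rightarrow>\<^sub>E Y. a \<in> convex hull (z ` g ` {..<M})})))"
proof -
  define D where "D = DIM('a)"
  define M where "M = (D + 2) ^ D"
  define A where "A = ({..<M} \<rightarrow>\<^sub>E {..<(2::nat) ^ D}) \<times> {..D}"
  have finA: "finite A" unfolding A_def by (intro finite_cartesian_product finite_PiE) auto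
  have Ane: "A \<noteq> {}" unfolding A_def by (auto simp: PiE_eq_empty_iff lessThan_empty_iff)
  have "\<exists>a. 1 / real (card A) * real (card Y) ^ M \<le>
      real (card {g \<in> {..<M} \<rightarrow>\<^sub>E Y. a \<in> convex hull (z ` g ` {..<M})})"
    if fin: "finite Y" and ne: "Y \<noteq> {}" for Y :: "nat set" and z :: "nat \<Rightarrow> 'a"
  proof -
    define X where "X col f s = convex hull (z ` f ` {p. p < M \<and> col p = s})" for col f and s :: nat
    define Q where "Q = (\<lambda>(col, j) f. closest_point (\<Inter>s\<in>{..D} - {j}. X col f s) 0 \<in> X col f j)"
    define J where "J = (\<lambda>(col, j::nat). {p. p < M \<and> col p = j})"
    have "\<exists>a\<in>A. Q a f" if f: "f \<in> {..<M} \<rightarrow>\<^sub>E Y" for f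
    proof -
      obtain col y where col: "\<And>p. col p < (2::nat) ^ D" and
        y: "\<And>j. j < 2 ^ D \<Longrightarrow> y \<in> convex hull ((z \<circ> f) ` {p. p < M \<and> col p = j})"
        using weak_Tverberg[of D "z \<circ> f"] unfolding M_def D_def by blast
      \<comment> \<open>Restriction puts the colouring into a finite set of labels that depends on
        the dimension only, not on \<open>Y\<close> or \<open>z\<close>.\<close>
      define col' where "col' = restrict col {..<M}"
      have col': "{p. p < M \<and> col' p = j} = {p. p < M \<and> col p = j}" for j
        by (auto simp: col'_def)
      have "y \<in> X col' f s" if "s \<le> D" for s
      proof -
        \<comment> \<open>Of the \<open>2 ^ D\<close> colour classes the first \<open>D + 1\<close>
          are used, as many as \<open>closest_point_of_subfamily\<close> requires.\<close>
        have "s < 2 ^ D" using that less_exp[of D] by linarith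
        then show ?thesis using y[of s] unfolding X_def col' by (simp add: image_comp)
      qed
      then have "(\<Inter>s\<in>{..D}. X col' f s) \<noteq> {}" by auto
      moreover have "closed (X col' f s)" for s
        unfolding X_def by (intro compact_imp_closed finite_imp_compact_convex_hull) auto
      ultimately obtain j where "j \<in> {..D}"
        "closest_point (\<Inter>s\<in>{..D} - {j}. X col' f s) 0 \<in> X col' f j"
        using closest_point_of_subfamily[of "{..D}" "X col' f"]
        by (auto simp: D_def X_def)
      moreover have "col' \<in> {..<M} \<rightarrow>\<^sub>E {..<2 ^ D}" using col by (auto simp: col'_def)
      ultimately show ?thesis
        by (intro bexI[of _ "(col', j)"]) (auto simp: A_def Q_def)
    qed
    moreover have "(\<Sum>y\<in>Y. 1 / real (card Y)) = 1" using fin ne by simp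
    ultimately obtain a f where a: "a \<in> A"
      and le: "1 / real (card A) \<le> (\<Sum>g\<in>{..<M} \<rightarrow>\<^sub>E Y. (\<Prod>p\<in>{..<M}. 1 / real (card Y)) *
      of_bool (Q a (override_on f g (J a))))"
      using resampling[OF fin finite_lessThan[of M] finA, where m = "\<lambda>_. 1 / real (card Y)" and J = J and Q = Q]
      by (metis (no_types, lifting) divide_nonneg_nonneg of_nat_0_le_iff zero_le_one)
    obtain col j where aj: "a = (col, j)" by fastforce
    define x where "x = closest_point (\<Inter>s\<in>{..D} - {j}. X col f s) 0"
    \<comment> \<open>Resampling replaces exactly the colour class \<open>j\<close>, so the closest
      point \<open>x\<close> for the other classes does not move.\<close>
    have eq: "override_on f g (J a) ` {p. p < M \<and> col p = s} =
       (if s = j then g else f) ` {p. p < M \<and> col p = s}" for g s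
      by (rule image_cong) (auto simp: override_on_def J_def aj)
    have X: "X col (override_on f g (J a)) s = (if s = j then X col g s else X col f s)" for g s
      unfolding X_def eq by simp
    have Qx: "Q a (override_on f g (J a)) \<longleftrightarrow> x \<in> X col g j" for g
      by (simp add: Q_def aj X[unfolded aj] x_def cong: INF_cong_simp)
    have sub: "X col g j \<subseteq> convex hull (z ` g ` {..<M})" for g
      unfolding X_def by (intro hull_mono image_mono) auto
    have finE: "finite ({..<M} \<rightarrow>\<^sub>E Y)" using fin by (simp add: finite_PiE)
    have "1 / real (card A) \<le> (\<Sum>g\<in>{..<M} \<rightarrow>\<^sub>E Y. (1 / real (card Y)) ^ M * of_bool (x \<in> X col g j))"
      using le unfolding Qx by simp
    also have "\<dots> = (1 / real (card Y)) ^ M * real (card {g \<in> {..<M} \<rightarrow>\<^sub>E Y. x \<in> X col g j})"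
      using finE by (simp add: sum_distrib_left[symmetric] sum.If_cases of_bool_def Int_def)
    also have "\<dots> \<le> (1 / real (card Y)) ^ M *
      real (card {g \<in> {..<M} \<rightarrow>\<^sub>E Y. x \<in> convex hull (z ` g ` {..<M})})"
      using finE sub by (intro mult_left_mono of_nat_mono card_mono) auto
    finally have "1 / real (card A) * real (card Y) ^ M \<le>
      real (card {g \<in> {..<M} \<rightarrow>\<^sub>E Y. x \<in> convex hull (z ` g ` {..<M})})"
      using fin ne by (simp add: field_simps card_gt_0_iff)
    then show ?thesis by blast
  qed
  moreover have "1 / real (card A) > 0" using finA Ane by (simp add: card_gt_0_iff)
  ultimately show ?thesis by blast
qed

text \<open>Greedy construction: while a heavy convex \<open>C\<close> is missed,
  \<open>selection\<close> on the points inside \<open>C\<close> gives a new point in the hulls of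
  many \<open>M\<close>-tuples. These hulls lie in \<open>C\<close>, so none of them was hit before,
  and the tuples run out after boundedly many rounds.\<close>

theorem weak_epsilon_net:
  assumes eps: "(0::real) < \<epsilon>"
  shows "\<exists>N::nat. \<forall>(Y::nat set) (z :: nat \<Rightarrow> 'a::euclidean_space). finite Y \<and> Y \<noteq> {} \<longrightarrow>
    (\<exists>A. finite A \<and> card A \<le> N \<and>
      (\<forall>C. convex C \<and> \<epsilon> * card Y \<le> card {t\<in>Y. z t \<in> C} \<longrightarrow> A \<inter> C \<noteq> {}))"
proof -
  obtain c M where c: "(0::real) < c" and sel: "\<forall>(Y::nat set) (z :: nat \<Rightarrow> 'a).
     finite Y \<and> Y \<noteq> {} \<longrightarrow> (\<exists>a. c * real (card Y) ^ M \<le>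
       real (card {g \<in> {..<M} \<rightarrow>\<^sub>E Y. a \<in> convex hull (z ` g ` {..<M})}))"
    using selection[where 'a = 'a] by (elim exE conjE) (rule that)
  \<comment> \<open>Fraction of tuples gained per round: at least \<open>\<epsilon> ^ M\<close> of
    them lie inside \<open>C\<close>, and \<open>selection\<close> hits a fraction \<open>c\<close>
    of those.\<close>
  define \<delta> where "\<delta> = c * \<epsilon> ^ M"
  have \<delta>: "\<delta> > 0" using c eps by (simp add: \<delta>_def)
  obtain N :: nat where N: "1 < real N * \<delta>"
    using reals_Archimedean3[OF \<delta>] by blast
  have "\<exists>A. finite A \<and> card A \<le> N \<and>
      (\<forall>C. convex C \<and> \<epsilon> * card Y \<le> card {t\<in>Y. z t \<in> C} \<longrightarrow> A \<inter> C \<noteq> {})"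
    if fin: "finite Y" and ne: "Y \<noteq> {}" for Y :: "nat set" and z :: "nat \<Rightarrow> 'a"
  proof -
    let ?E = "{..<M} \<rightarrow>\<^sub>E Y"
    define H where "H g = convex hull (z ` g ` {..<M})" for g
    have finE: "finite ?E" using fin by (simp add: finite_PiE)
    define net where "net A \<longleftrightarrow> (\<forall>C. convex C \<and> \<epsilon> * card Y \<le> card {t\<in>Y. z t \<in> C} \<longrightarrow> A \<inter> C \<noteq> {})" for A
    have "\<exists>A. finite A \<and> card A \<le> k \<and>
       (net A \<or> real k * \<delta> * real (card Y) ^ M \<le> card {g\<in>?E. A \<inter> H g \<noteq> {}})" for k
    proof (induction k)
      case 0
      show ?case by (intro exI[of _ "{}"]) auto
    next
      case (Suc k)
      then obtain A where A: "finite A" "card A \<le> k"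
        "net A \<or> real k * \<delta> * real (card Y) ^ M \<le> card {g\<in>?E. A \<inter> H g \<noteq> {}}" by blast
      show ?case
      proof (cases "net A")
        case True
        then show ?thesis using A by (intro exI[of _ A]) auto
      next
        case False
        then obtain C where C: "convex C" "\<epsilon> * card Y \<le> card {t\<in>Y. z t \<in> C}" "A \<inter> C = {}"
          by (auto simp: net_def)
        define Y' where "Y' = {t\<in>Y. z t \<in> C}"
        have finY': "finite Y'" using fin by (simp add: Y'_def)
        have "0 < \<epsilon> * card Y" using eps fin ne by (simp add: card_gt_0_iff)
        then have "Y' \<noteq> {}" using C(2) unfolding Y'_def[symmetric] by auto
        then obtain a where a: "c * real (card Y') ^ M \<le> card {g \<in> {..<M} \<rightarrow>\<^sub>E Y'. a \<in> H g}"
          using sel finY' unfolding H_def by blast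
        have HC: "H g \<subseteq> C" if "g \<in> {..<M} \<rightarrow>\<^sub>E Y'" for g
          unfolding H_def using that C(1) by (intro hull_minimal) (auto simp: Y'_def dest: PiE_mem)
        have sub: "{..<M} \<rightarrow>\<^sub>E Y' \<subseteq> ?E" by (intro PiE_mono) (auto simp: Y'_def)
        have "(\<epsilon> * card Y) ^ M \<le> real (card Y') ^ M"
          using C(2) eps by (intro power_mono) (auto simp: Y'_def)
        then have "\<delta> * real (card Y) ^ M \<le> c * real (card Y') ^ M"
          using c by (simp add: \<delta>_def power_mult_distrib)
        then have "real (Suc k) * \<delta> * real (card Y) ^ M
          \<le> card {g\<in>?E. A \<inter> H g \<noteq> {}} + card {g \<in> {..<M} \<rightarrow>\<^sub>E Y'. a \<in> H g}"
          using A(3) False a by (simp add: algebra_simps)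
        also have "\<dots> = card ({g\<in>?E. A \<inter> H g \<noteq> {}} \<union> {g \<in> {..<M} \<rightarrow>\<^sub>E Y'. a \<in> H g})"
        proof (subst card_Un_disjoint)
          show "finite {g \<in> {..<M} \<rightarrow>\<^sub>E Y'. a \<in> H g}" using finY' by (simp add: finite_PiE)
          show "{g\<in>?E. A \<inter> H g \<noteq> {}} \<inter> {g \<in> {..<M} \<rightarrow>\<^sub>E Y'. a \<in> H g} = {}"
            using HC C(3) by blast
        qed (use finE in auto)
        also have "\<dots> \<le> card {g\<in>?E. insert a A \<inter> H g \<noteq> {}}"
          using finE sub by (intro of_nat_mono card_mono) auto
        finally show ?thesis
          using A(1,2) by (intro exI[of _ "insert a A"]) (auto simp: card_insert_if)
      qed
    qed
    then obtain A where A: "finite A" "card A \<le> N"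
       "net A \<or> real N * \<delta> * real (card Y) ^ M \<le> card {g\<in>?E. A \<inter> H g \<noteq> {}}" by blast
    have "real (card {g\<in>?E. A \<inter> H g \<noteq> {}}) \<le> card ?E"
      using finE by (intro of_nat_mono card_mono) auto
    also have "\<dots> = 1 * real (card Y) ^ M" by (simp add: card_PiE)
    also have "\<dots> < real N * \<delta> * real (card Y) ^ M"
      using N fin ne by (intro mult_strict_right_mono) (auto simp: card_gt_0_iff)
    finally have "net A" using A(3) by simp
    then show ?thesis using A unfolding net_def by blast
  qed
  then show ?thesis by blast
qed

subsection \<open>Fractional transversals\<close>

text \<open>A multiplicative weights argument in place of linear programming duality: each chosen point
  halves the weights of the sets it hits, so a rarely hit set would keep too much weight.\<close>
lemma multiplicative_weights:
  fixes hit :: "'z \<Rightarrow> 'k \<Rightarrow> bool"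
  assumes finF: "finite F" and \<beta>: "0 < \<beta>" "\<beta> \<le> 1"
    and step: "\<And>m. (\<And>K. K \<in> F \<Longrightarrow> 0 \<le> m K) \<Longrightarrow> sum m F = 1 \<Longrightarrow>
      \<exists>z. \<beta> \<le> (\<Sum>K\<in>F. m K * of_bool (hit z K))"
  shows "\<exists>T>0. \<exists>z. \<forall>K\<in>F. \<beta> / 4 * real T \<le> card {t\<in>{..<T}. hit (z t) K}"
proof (cases "F = {}")
  case True
  then show ?thesis by auto
next
  case False
  define h where "h z T K = card {t\<in>{..<T}. hit (z t) K}" for z and T :: nat and K
  define \<Phi> where "\<Phi> z T = (\<Sum>K\<in>F. (1 / 2 :: real) ^ h z T K)" for z T
  have \<Phi>pos: "\<Phi> z T > 0" for z T
    unfolding \<Phi>_def using False finF by (intro sum_pos) auto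
  have "\<exists>z. \<Phi> z T \<le> card F * (1 - \<beta> / 2) ^ T" for T
  proof (induction T)
    case 0
    show ?case by (simp add: \<Phi>_def h_def)
  next
    case (Suc T)
    then obtain z where z: "\<Phi> z T \<le> card F * (1 - \<beta> / 2) ^ T" by blast
    \<comment> \<open>The normalised weights are the distribution given to \<open>step\<close>.
      Halving a part of mass at least \<open>\<beta>\<close> shrinks the potential by a factor of at
      most \<open>1 - \<beta> / 2\<close>.\<close>
    define m where "m K = (1 / 2) ^ h z T K / \<Phi> z T" for K
    have "sum m F = 1"
      using \<Phi>pos[of z T] unfolding m_def sum_divide_distrib[symmetric] \<Phi>_def[symmetric] by simp
    moreover have "0 \<le> m K" for K using \<Phi>pos[of z T] by (simp add: m_def)
    ultimately obtain y where y: "\<beta> \<le> (\<Sum>K\<in>F. m K * of_bool (hit y K))"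
      using step by blast
    have "(\<Sum>K\<in>F. m K * of_bool (hit y K)) = (\<Sum>K\<in>F. (1 / 2) ^ h z T K * of_bool (hit y K)) / \<Phi> z T"
      by (simp add: m_def sum_divide_distrib)
    then have y': "\<beta> * \<Phi> z T \<le> (\<Sum>K\<in>F. (1 / 2) ^ h z T K * of_bool (hit y K))"
      using y \<Phi>pos[of z T] by (simp add: pos_le_divide_eq)
    define z' where "z' = z(T := y)"
    have h': "h z' (Suc T) K = h z T K + of_bool (hit y K)" for K
    proof -
      have "{t\<in>{..<Suc T}. hit (z' t) K}
        = {t\<in>{..<T}. hit (z t) K} \<union> (if hit y K then {T} else {})"
        by (auto simp: z'_def less_Suc_eq)
      then show ?thesis by (simp add: h_def)
    qed
    have "\<Phi> z' (Suc T) = (\<Sum>K\<in>F. (1 / 2) ^ h z T K - (1 / 2) * ((1 / 2) ^ h z T K * of_bool (hit y K)))"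
      unfolding \<Phi>_def h' by (intro sum.cong) auto
    also have "\<dots> = \<Phi> z T - (1 / 2) * (\<Sum>K\<in>F. (1 / 2) ^ h z T K * of_bool (hit y K))"
      by (simp only: sum_subtractf sum_distrib_left \<Phi>_def)
    also have "\<dots> \<le> (1 - \<beta> / 2) * \<Phi> z T" using y' by (simp add: algebra_simps)
    also have "\<dots> \<le> (1 - \<beta> / 2) * (card F * (1 - \<beta> / 2) ^ T)"
      using z \<beta> by (intro mult_left_mono) auto
    finally show ?case by (intro exI[of _ z']) (simp add: mult_ac)
  qed
  note ex = this
  define n where "n = real (card F)"
  have n: "n \<ge> 1" unfolding n_def using False finF by (simp add: Suc_le_eq card_gt_0_iff)
  \<comment> \<open>Large enough that \<open>ln n\<close> consumes at most half of the exponent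
    \<open>\<beta> / 2 * T\<close>, which leaves \<open>\<beta> / 4 * T\<close>.\<close>
  define T where "T = nat \<lceil>4 * ln n / \<beta>\<rceil> + 1"
  have T: "ln n \<le> \<beta> / 4 * real T"
  proof -
    have "4 * ln n / \<beta> \<le> real T" unfolding T_def by linarith
    then show ?thesis using \<beta> by (simp add: field_simps)
  qed
  obtain z where z: "\<Phi> z T \<le> n * (1 - \<beta> / 2) ^ T" using ex n_def by blast
  have "\<beta> / 4 * real T \<le> h z T K" if K: "K \<in> F" for K
  proof -
    \<comment> \<open>A single weight is at most the whole potential; logarithms turn this into a
      lower bound on the number of hits.\<close>
    have "(1 / 2 :: real) ^ h z T K \<le> \<Phi> z T"
      unfolding \<Phi>_def using K finF by (intro member_le_sum) auto
    also have "\<dots> \<le> n * (1 - \<beta> / 2) ^ T" by (rule z)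
    also have "\<dots> \<le> n * exp (- (\<beta> / 2)) ^ T"
      using \<beta> n exp_ge_add_one_self[of "- (\<beta> / 2)"] by (intro mult_left_mono power_mono) auto
    finally have "ln ((1 / 2 :: real) ^ h z T K) \<le> ln (n * exp (- (\<beta> / 2)) ^ T)"
      using n by (subst ln_le_cancel_iff) auto
    then have "- (real (h z T K) * ln 2) \<le> ln n - \<beta> / 2 * real T"
      using n by (simp add: ln_realpow ln_mult ln_div mult_ac)
    moreover have "real (h z T K) * ln 2 \<le> real (h z T K)"
      using ln_2_less_1 by (simp add: mult_left_le)
    ultimately show ?thesis using T by linarith
  qed
  moreover have "T > 0" by (simp add: T_def)
  ultimately show ?thesis unfolding h_def by blast
qed

subsection \<open>Families whose small subfamilies have large extent\<close>

text \<open>\<open>ramsey_full\<close> is transported along an injection \<open>e\<close> of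
  \<open>{..<R}\<close> into \<open>H\<close> and a numbering \<open>b\<close> of the
  colours.\<close>

lemma Ramsey_colours:
  assumes finQ: "finite Q"
  shows "\<exists>R. \<forall>(H::nat set) c. finite H \<and> R \<le> card H \<and> (\<forall>J\<subseteq>H. card J = k \<longrightarrow> c J \<in> Q) \<longrightarrow>
    (\<exists>q\<in>Q. \<exists>S\<subseteq>H. card S = n \<and> (\<forall>J\<subseteq>S. card J = k \<longrightarrow> c J = q))"
proof -
  obtain b where b: "bij_betw b Q {0..<card Q}"
    using ex_bij_betw_finite_nat[OF finQ] by blast
  obtain R :: nat where R: "partn_lst {..<R} (replicate (card Q) n) k"
    using ramsey_full[of "replicate (card Q) n" k] by blast
  have "\<exists>q\<in>Q. \<exists>S\<subseteq>H. card S = n \<and> (\<forall>J\<subseteq>S. card J = k \<longrightarrow> c J = q)"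
    if H: "finite H" "R \<le> card H" and c: "\<forall>J\<subseteq>H. card J = k \<longrightarrow> c J \<in> Q" for H :: "nat set" and c
  proof -
    obtain e where e: "e ` {..<R} \<subseteq> H" "inj_on e {..<R}"
      using card_le_inj[of "{..<R}" H] H by auto
    have cQ: "c (e ` J) \<in> Q" if "J \<in> nsets {..<R} k" for J
    proof -
      have "e ` J \<subseteq> H" "card (e ` J) = k"
        using that e by (auto simp: nsets_def card_image inj_on_subset)
      then show ?thesis using c by blast
    qed
    have "b (c (e ` J)) < card Q" if "J \<in> nsets {..<R} k" for J
      using b cQ[OF that] by (auto simp: bij_betw_def)
    then have "(\<lambda>J. b (c (e ` J))) \<in> nsets {..<R} k \<rightarrow> {..<length (replicate (card Q) n)}" by auto
    then obtain i S where i: "i < card Q" and S: "S \<in> nsets {..<R} n"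
      and mono: "(\<lambda>J. b (c (e ` J))) ` nsets S k \<subseteq> {i}"
      using R unfolding partn_lst_def monochromatic_def by (metis length_replicate nth_replicate)
    obtain q where q: "q \<in> Q" "b q = i"
      using b i by (metis atLeastLessThan_iff bij_betw_iff_bijections le0)
    have SR: "S \<subseteq> {..<R}" "card S = n" "finite S" using S by (auto simp: nsets_def)
    have eS: "inj_on e S" using e(2) SR(1) inj_on_subset by blast
    have "c J' = q" if J': "J' \<subseteq> e ` S" "card J' = k" for J'
    proof -
      obtain J where J: "J \<subseteq> S" "J' = e ` J" using J'(1) by (meson subset_imageE)
      have "card J = k" using J J'(2) eS by (metis card_image inj_on_subset)
      then have Jn: "J \<in> nsets S k" using J(1) SR(3) by (auto simp: nsets_def finite_subset)
      then have "b (c J') = b q" using mono J(2) q(2) by auto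
      moreover have "c J' \<in> Q" using cQ[of J] Jn J(2) nsets_mono[OF SR(1)] by blast
      ultimately show ?thesis using b q(1) by (auto simp: bij_betw_def inj_on_def)
    qed
    moreover have "e ` S \<subseteq> H" "card (e ` S) = n" using e(1) SR eS by (auto simp: card_image)
    ultimately show ?thesis using q(1) by blast
  qed
  then show ?thesis by blast
qed

text \<open>The supremum in \<open>ediam\<close> need not be attained, hence the drop from 1 to 1/2.
  The Euclidean norm is at most the sum of the absolute coordinates, so one of them exceeds the
  average.\<close>

lemma ediam_ge_1_imp_extent:
  fixes S :: "(real^'n) set"
  assumes "1 \<le> ediam S"
  shows "\<exists>i. \<exists>x\<in>S. \<exists>y\<in>S. 1 / (2 * real CARD('n)) \<le> y $ i - x $ i"
proof -
  have "ereal (1 / 2) < ediam S" using assms by (rule less_le_trans[rotated]) simp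
  then obtain x y where xy: "x \<in> S" "y \<in> S" "1 / 2 < dist x y"
    unfolding ediam_def less_Sup_iff by auto
  have "\<exists>i. 1 / (2 * real CARD('n)) < \<bar>(x - y) $ i\<bar>"
  proof (rule ccontr)
    assume "\<not> ?thesis"
    then have "(\<Sum>i\<in>UNIV. \<bar>(x - y) $ i\<bar>) \<le> real CARD('n) * (1 / (2 * real CARD('n)))"
      by (intro sum_bounded_above) (auto simp: not_less)
    then show False using norm_le_l1_cart[of "x - y"] xy(3) by (simp add: dist_norm)
  qed
  then obtain i where "1 / (2 * real CARD('n)) < \<bar>x $ i - y $ i\<bar>" by auto
  then have "1 / (2 * real CARD('n)) \<le> y $ i - x $ i \<or> 1 / (2 * real CARD('n)) \<le> x $ i - y $ i"
    by linarith
  then show ?thesis using xy(1,2) by blast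
qed

text \<open>All the sets share a point at some height \<open>t\<close> in direction \<open>i\<close>, hence any \<open>CARD('n)\<close> of
  them meet at height \<open>t + w / 2\<close> or at height \<open>t - w / 2\<close>. After Ramsey's theorem the same choice
  works for all subfamilies, and \<open>CARD('n)\<close> is the Helly number of a hyperplane.\<close>
lemma Helly_extent:
  "\<exists>R. \<forall>(f :: nat \<Rightarrow> (real^'n) set) H i w. finite H \<and> R \<le> card H \<and> 0 < w \<and> (\<forall>s\<in>H. convex (f s)) \<and>
     (\<forall>J\<subseteq>H. card J = CARD('n) + 1 \<longrightarrow>
       (\<exists>x\<in>\<Inter>s\<in>J. f s. \<exists>y\<in>\<Inter>s\<in>J. f s. w \<le> y $ i - x $ i)) \<longrightarrow>
     (\<exists>S\<subseteq>H. card S = N \<and> (\<exists>x\<in>\<Inter>s\<in>S. f s. \<exists>y\<in>\<Inter>s\<in>S. f s. w / 2 \<le> y $ i - x $ i))"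
proof -
  define d where "d = CARD('n)"
  \<comment> \<open>The summand \<open>d\<close> guarantees enough sets for
    \<open>Helly_relative\<close>; only \<open>N\<close> of them are kept at the end.\<close>
  obtain R where R: "\<forall>(H::nat set) (c :: nat set \<Rightarrow> bool). finite H \<and> R \<le> card H \<and>
      (\<forall>J\<subseteq>H. card J = d \<longrightarrow> c J \<in> UNIV) \<longrightarrow>
      (\<exists>q\<in>UNIV. \<exists>S\<subseteq>H. card S = N + d \<and> (\<forall>J\<subseteq>S. card J = d \<longrightarrow> c J = q))"
    using Ramsey_colours[OF finite[of "UNIV :: bool set"], of d "N + d"] by (elim exE) (rule that)
  have main: "\<exists>S\<subseteq>H. card S = N \<and> (\<exists>x\<in>\<Inter>s\<in>S. f s. \<exists>y\<in>\<Inter>s\<in>S. f s. w / 2 \<le> y $ i - x $ i)"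
    if finH: "finite H" and cardH: "R + d + 1 \<le> card H" and w: "0 < w"
      and convs: "\<forall>s\<in>H. convex (f s)"
      and exts: "\<forall>J\<subseteq>H. card J = d + 1 \<longrightarrow>
        (\<exists>x\<in>\<Inter>s\<in>J. f s. \<exists>y\<in>\<Inter>s\<in>J. f s. w \<le> y $ i - x $ i)"
    for f :: "nat \<Rightarrow> (real^'n) set" and H i w
  proof -
    note conv = convs[rule_format] and ext = exts[rule_format]
    have "(\<Inter>s\<in>H. f s) \<noteq> {}"
    proof (rule Helly_indexed[OF finH])
      show "(\<Inter>s\<in>J. f s) \<noteq> {}" if "J \<subseteq> H" "card J = DIM(real^'n) + 1" for J
        using ext[OF that(1)] that(2) unfolding d_def by auto
    qed (use cardH conv in \<open>auto simp: d_def\<close>)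
    then obtain z where z: "\<And>s. s \<in> H \<Longrightarrow> z \<in> f s" by auto
    define lev where "lev b = {x :: real^'n. x $ i = (if b then z $ i + w / 2 else z $ i - w / 2)}" for b
    have convlev: "convex (lev b)" for b
      unfolding lev_def by (auto simp: convex_def simp flip: distrib_right)
    \<comment> \<open>The intersection over \<open>J\<close> contains \<open>z\<close> and has
      extent \<open>w\<close>, so it reaches \<open>w / 2\<close> above or below \<open>z\<close>;
      the intermediate value theorem gives a point on that level.\<close>
    have lev: "\<exists>b. lev b \<inter> (\<Inter>s\<in>J. f s) \<noteq> {}" if J: "J \<subseteq> H" "card J = d" for J
    proof -
      obtain J' where J': "J \<subseteq> J'" "J' \<subseteq> H" "card J' = d + 1"
        using exists_subset_between[of J "d + 1" H] J cardH finH by auto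
      then obtain x y where "x \<in> (\<Inter>s\<in>J'. f s)" "y \<in> (\<Inter>s\<in>J'. f s)" and xyw: "w \<le> y $ i - x $ i"
        using ext by blast
      then have xy: "x \<in> (\<Inter>s\<in>J. f s)" "y \<in> (\<Inter>s\<in>J. f s)" using J'(1) by auto
      have zJ: "z \<in> (\<Inter>s\<in>J. f s)" using z J(1) by auto
      have con: "connected (\<Inter>s\<in>J. f s)"
        using conv J(1) by (intro convex_connected convex_INT) auto
      consider "z $ i + w / 2 \<le> y $ i" | "x $ i \<le> z $ i - w / 2" using xyw by linarith
      then show ?thesis
      proof cases
        case 1
        then have "\<exists>u\<in>\<Inter>s\<in>J. f s. u $ i = z $ i + w / 2"
          using w by (intro connected_ivt_component_cart[OF con zJ xy(2)]) auto
        then show ?thesis by (intro exI[of _ True]) (auto simp: lev_def)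
      next
        case 2
        then have "\<exists>u\<in>\<Inter>s\<in>J. f s. u $ i = z $ i - w / 2"
          using w by (intro connected_ivt_component_cart[OF con xy(1) zJ]) auto
        then show ?thesis by (intro exI[of _ False]) (auto simp: lev_def)
      qed
    qed
    \<comment> \<open>If level \<open>True\<close> is missed, \<open>lev\<close> gives level
      \<open>False\<close>. The monochromatic colour \<open>q\<close> is thus itself a level met by
      any \<open>d\<close> sets of \<open>S\<close>.\<close>
    define c where "c J \<longleftrightarrow> lev True \<inter> (\<Inter>s\<in>J. f s) \<noteq> {}" for J
    have "R \<le> card H" using cardH by simp
    then obtain q S where S: "S \<subseteq> H" "card S = N + d" and q: "\<And>J. J \<subseteq> S \<Longrightarrow> card J = d \<Longrightarrow> c J = q"
      using R[rule_format, of H c] finH by auto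
    have "lev q \<inter> (\<Inter>s\<in>S. f s) \<noteq> {}"
    proof (rule Helly_relative)
      show "finite S" using S(1) finH finite_subset by blast
      show "DIM(real^'n) \<le> card S" using S(2) by (simp add: d_def)
      show "convex (f s)" if "s \<in> S" for s using conv S(1) that by blast
      show "convex (lev q)" by (rule convlev)
      show "(\<Inter>s\<in>J. f s) \<noteq> {}" if "J \<subseteq> S" for J
        using z that S(1) by blast
      show "lev q \<inter> (\<Inter>s\<in>J. f s) \<noteq> {}" if "J \<subseteq> S" "card J = DIM(real^'n)" for J
      proof -
        have Jd: "card J = d" using that(2) by (simp add: d_def)
        have "\<exists>b. lev b \<inter> (\<Inter>s\<in>J. f s) \<noteq> {}" using lev[of J] that(1) S(1) Jd by blast
        then show ?thesis using q[OF that(1) Jd] unfolding c_def by (cases q) (metis (full_types))+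
      qed
    qed
    then obtain u where u: "u \<in> lev q" "u \<in> (\<Inter>s\<in>S. f s)" by blast
    obtain S' where S': "S' \<subseteq> S" "card S' = N"
      using obtain_subset_with_card_n[of N S] S(2) by auto
    have u': "u \<in> (\<Inter>s\<in>S'. f s)" and z': "z \<in> (\<Inter>s\<in>S'. f s)" using u(2) z S(1) S'(1) by auto
    have "w / 2 \<le> u $ i - z $ i \<or> w / 2 \<le> z $ i - u $ i"
      using u(1) by (cases q) (auto simp: lev_def)
    then have "\<exists>x\<in>\<Inter>s\<in>S'. f s. \<exists>y\<in>\<Inter>s\<in>S'. f s. w / 2 \<le> y $ i - x $ i"
      using u' z' by blast
    then show ?thesis using S' S(1) by blast
  qed
  show ?thesis
    unfolding d_def[symmetric]
    by (intro exI[of _ "R + d + 1"] allI impI, elim conjE) (rule main; assumption)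
qed

text \<open>Each subset of size \<open>CARD('n) + 1\<close> is coloured by a direction in which its
  intersection has extent \<open>w\<close>, or by \<open>None\<close>. The hypothesis forbids a set
  of \<open>p\<close> indices with colour \<open>None\<close> throughout, so a large set has one
  common direction, and \<open>Helly_extent\<close> applies.\<close>

lemma Ramsey_extent:
  "\<exists>R. \<forall>(f :: nat \<Rightarrow> (real^'n) set) H. finite H \<and> R \<le> card H \<and> (\<forall>s\<in>H. convex (f s)) \<and>
     (\<forall>G\<subseteq>H. card G = p \<longrightarrow> (\<exists>J\<subseteq>G. card J = CARD('n) + 1 \<and> 1 \<le> ediam (\<Inter>s\<in>J. f s))) \<longrightarrow>
     (\<exists>i. \<exists>S\<subseteq>H. card S = N \<and>
       (\<exists>x\<in>\<Inter>s\<in>S. f s. \<exists>y\<in>\<Inter>s\<in>S. f s. 1 / (4 * real CARD('n)) \<le> y $ i - x $ i))"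
proof -
  define w where "w = 1 / (2 * real CARD('n))"
  have w: "0 < w" by (simp add: w_def)
  define good where "good f J i \<longleftrightarrow> (\<exists>x\<in>\<Inter>s\<in>J. f s. \<exists>y\<in>\<Inter>s\<in>J. f s. w \<le> y $ i - x $ i)"
    for f :: "nat \<Rightarrow> (real^'n) set" and J i
  obtain R1 where R1: "\<forall>(f :: nat \<Rightarrow> (real^'n) set) H i w. finite H \<and> R1 \<le> card H \<and> 0 < w \<and>
     (\<forall>s\<in>H. convex (f s)) \<and> (\<forall>J\<subseteq>H. card J = CARD('n) + 1 \<longrightarrow>
       (\<exists>x\<in>\<Inter>s\<in>J. f s. \<exists>y\<in>\<Inter>s\<in>J. f s. w \<le> y $ i - x $ i)) \<longrightarrow>
     (\<exists>S\<subseteq>H. card S = N \<and> (\<exists>x\<in>\<Inter>s\<in>S. f s. \<exists>y\<in>\<Inter>s\<in>S. f s. w / 2 \<le> y $ i - x $ i))"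
    using Helly_extent[where 'n = 'n and N = N] by (elim exE) (rule that)
  \<comment> \<open>\<open>p + R1\<close> leaves room both for a \<open>p\<close>-subset, which
    rules out \<open>None\<close>, and for the \<open>R1\<close> sets that
    \<open>Helly_extent\<close> needs.\<close>
  obtain R where R: "\<forall>(H::nat set) (c :: nat set \<Rightarrow> 'n option). finite H \<and> R \<le> card H \<and>
      (\<forall>J\<subseteq>H. card J = CARD('n) + 1 \<longrightarrow> c J \<in> UNIV) \<longrightarrow>
      (\<exists>q\<in>UNIV. \<exists>S\<subseteq>H. card S = p + R1 \<and> (\<forall>J\<subseteq>S. card J = CARD('n) + 1 \<longrightarrow> c J = q))"
    using Ramsey_colours[OF finite[of "UNIV :: 'n option set"], of "CARD('n) + 1" "p + R1"] by (elim exE) (rule that)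
  have main: "\<exists>i. \<exists>S\<subseteq>H. card S = N \<and>
       (\<exists>x\<in>\<Inter>s\<in>S. f s. \<exists>y\<in>\<Inter>s\<in>S. f s. 1 / (4 * real CARD('n)) \<le> y $ i - x $ i)"
    if finH: "finite H" and cardH: "R \<le> card H" and conv: "\<forall>s\<in>H. convex (f s)"
      and pq: "\<forall>G\<subseteq>H. card G = p \<longrightarrow> (\<exists>J\<subseteq>G. card J = CARD('n) + 1 \<and> 1 \<le> ediam (\<Inter>s\<in>J. f s))"
    for f :: "nat \<Rightarrow> (real^'n) set" and H
  proof -
    define c where "c J = (if \<exists>i. good f J i then Some (SOME i. good f J i) else None)" for J
    obtain q S where S: "S \<subseteq> H" "card S = p + R1"
      and q: "\<And>J. J \<subseteq> S \<Longrightarrow> card J = CARD('n) + 1 \<Longrightarrow> c J = q"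
      using R[rule_format, of H c] finH cardH by auto
    have finS: "finite S" using S(1) finH finite_subset by blast
    show ?thesis
    proof (cases q)
      case None
      obtain G where G: "G \<subseteq> S" "card G = p"
        using obtain_subset_with_card_n[of p S] S(2) by auto
      have "G \<subseteq> H" using G(1) S(1) by blast
      then obtain J where J: "J \<subseteq> G" "card J = CARD('n) + 1" "1 \<le> ediam (\<Inter>s\<in>J. f s)"
        using pq[rule_format, of G] G(2) by blast
      have "\<exists>i. good f J i" using ediam_ge_1_imp_extent[OF J(3)] unfolding good_def w_def .
      then have "c J \<noteq> None" by (simp add: c_def)
      then show ?thesis using q[of J] J G None by auto
    next
      case (Some i)
      have "good f J i" if J: "J \<subseteq> S" "card J = CARD('n) + 1" for J
      proof -
        have cJ: "c J = Some i" using q[OF J] Some by simp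
        then have ex: "\<exists>i. good f J i" by (metis c_def option.distinct(1))
        then have "i = (SOME i. good f J i)" using cJ by (simp add: c_def)
        then show ?thesis using someI_ex[OF ex] by simp
      qed
      then have "finite S \<and> R1 \<le> card S \<and> 0 < w \<and> (\<forall>s\<in>S. convex (f s)) \<and>
        (\<forall>J\<subseteq>S. card J = CARD('n) + 1 \<longrightarrow>
          (\<exists>x\<in>\<Inter>s\<in>J. f s. \<exists>y\<in>\<Inter>s\<in>J. f s. w \<le> y $ i - x $ i))"
        using finS S w conv unfolding good_def by (auto simp del: One_nat_def Suc_eq_plus1)
      from mp[OF R1[THEN spec[of _ f], THEN spec[of _ S], THEN spec[of _ i], THEN spec[of _ w]] this]
      have "\<exists>T\<subseteq>S. card T = N \<and> (\<exists>x\<in>\<Inter>s\<in>T. f s. \<exists>y\<in>\<Inter>s\<in>T. f s. w / 2 \<le> y $ i - x $ i)" .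
      then show ?thesis using S(1) unfolding w_def by (auto intro!: exI[of _ i])
    qed
  qed
  show ?thesis by (intro exI[of _ R] allI impI, elim conjE) (rule main; assumption)
qed

text \<open>Draws may repeat members of \<open>F\<close>. Either \<open>p\<close> distinct sets
  occur and \<open>pq\<close> applies, or by pigeonhole one set occurs at least
  \<open>CARD('n) + 1\<close> times and its own diameter suffices.\<close>

lemma pq_indexed:
  assumes f: "f ` G \<subseteq> F" and card: "card G = p * (CARD('n::finite) + 1)" and p: "0 < p"
    and diam: "\<And>K. K \<in> F \<Longrightarrow> 1 \<le> ediam K"
    and pq: "\<And>G. G \<subseteq> F \<Longrightarrow> card G = p \<Longrightarrow>
      \<exists>H\<subseteq>G. card H = CARD('n) + 1 \<and> 1 \<le> ediam (\<Inter>H)"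
  shows "\<exists>J\<subseteq>G. card J = CARD('n) + 1 \<and> 1 \<le> ediam (\<Inter>s\<in>J. f s)"
proof (cases "p \<le> card (f ` G)")
  case True
  then obtain G' where G': "G' \<subseteq> f ` G" "card G' = p"
    using obtain_subset_with_card_n by blast
  then obtain H where H: "H \<subseteq> f ` G" "card H = CARD('n) + 1" "1 \<le> ediam (\<Inter>H)"
    using pq[of G'] f by (meson subset_trans)
  then obtain J where J: "J \<subseteq> G" "inj_on f J" "H = f ` J" by (meson subset_image_inj)
  then show ?thesis using H by (intro exI[of _ J]) (simp add: card_image)
next
  case False
  have finG: "finite G" using card p by (intro card_ge_0_finite) simp
  have "\<exists>y\<in>f ` G. CARD('n) + 1 \<le> card {x\<in>G. f x = y}"
  proof (rule ccontr)
    assume contra: "\<not> ?thesis"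
    have "card G = (\<Sum>y\<in>f ` G. card {x\<in>G. f x = y})"
      using sum.image_gen[OF finG, of "\<lambda>_. 1::nat" f] by simp
    also have "\<dots> \<le> card (f ` G) * (CARD('n) + 1)"
    proof -
      have "card {x\<in>G. f x = y} \<le> CARD('n) + 1" if "y \<in> f ` G" for y
        using contra that by force
      then show ?thesis
        using sum_bounded_above[of "f ` G" "\<lambda>y. card {x\<in>G. f x = y}" "CARD('n) + 1"] by simp
    qed
    also have "\<dots> < p * (CARD('n) + 1)" using False by (intro mult_strict_right_mono) auto
    finally show False using card by simp
  qed
  then obtain y where y: "y \<in> f ` G" "CARD('n) + 1 \<le> card {x\<in>G. f x = y}" by blast
  obtain J where J: "J \<subseteq> {x\<in>G. f x = y}" "card J = CARD('n) + 1"
    using obtain_subset_with_card_n[OF y(2)] by (metis (no_types, lifting))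
  then have "J \<noteq> {}" by auto
  then have "(\<Inter>s\<in>J. f s) = y" using J(1) by (auto simp: subset_iff)
  then show ?thesis using J diam[of y] y(1) f by (intro exI[of _ J]) auto
qed

section \<open>From points in the lifts to a bounded family of segments\<close>

theorem theorem5:
  "\<exists>v::real. v > 0 \<and>
     (\<forall>p::nat. p \<ge> CARD('n) + 1 \<longrightarrow>
       (\<exists>r::nat. \<forall>F :: (real^'n) set set.
          finite F \<and> (\<forall>K\<in>F. convex K \<and> ediam K \<ge> 1) \<and>
          (\<forall>G\<subseteq>F. card G = p \<longrightarrow>
             (\<exists>H\<subseteq>G. card H = CARD('n) + 1 \<and> ediam (\<Inter>H) \<ge> 1))
          \<longrightarrow>
          (\<exists>C :: (real^'n) set set. finite C \<and> card C \<le> r \<and>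
             (\<forall>c\<in>C. convex c \<and> ediam c \<ge> ereal v) \<and>
             (\<forall>K\<in>F. \<exists>c\<in>C. c \<subseteq> K))))"
proof -
  define d where "d = CARD('n)"
  have d: "0 < d" by (simp add: d_def)
  \<comment> \<open>The extent \<open>1 / (2 * d)\<close> from \<open>ediam_ge_1_imp_extent\<close>,
    halved by \<open>Helly_extent\<close>.\<close>
  define v where "v = 1 / (4 * real d)"
  have v: "0 < v" using d by (simp add: v_def)
  define L :: "'n \<Rightarrow> (real^'n) set \<Rightarrow> ((real^'n) \<times> (real^'n)) set"
    where "L i K = {(x, y). x \<in> K \<and> y \<in> K \<and> v \<le> y $ i - x $ i}" for i K
  have convL: "convex (L i K)" if "convex K" for i K
  proof -
    have "L i K = (K \<times> K) \<inter> {q. v \<le> snd q $ i - fst q $ i}" by (auto simp: L_def)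
    moreover have "convex {q :: (real^'n) \<times> (real^'n). v \<le> snd q $ i - fst q $ i}"
    proof -
      have "linear (\<lambda>q :: (real^'n) \<times> (real^'n). snd q $ i - fst q $ i)"
        by (auto intro!: linearI simp: algebra_simps)
      then have "convex ((\<lambda>q :: (real^'n) \<times> (real^'n). snd q $ i - fst q $ i) -` {v..})"
        by (intro convex_linear_vimage) auto
      then show ?thesis by (simp add: vimage_def)
    qed
    ultimately show ?thesis using that by (simp add: convex_Int convex_Times)
  qed
  have "\<exists>r::nat. \<forall>F :: (real^'n) set set.
          finite F \<and> (\<forall>K\<in>F. convex K \<and> ediam K \<ge> 1) \<and>
          (\<forall>G\<subseteq>F. card G = p \<longrightarrow>
             (\<exists>H\<subseteq>G. card H = CARD('n) + 1 \<and> ediam (\<Inter>H) \<ge> 1))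
          \<longrightarrow>
          (\<exists>C :: (real^'n) set set. finite C \<and> card C \<le> r \<and>
             (\<forall>c\<in>C. convex c \<and> ediam c \<ge> ereal v) \<and>
             (\<forall>K\<in>F. \<exists>c\<in>C. c \<subseteq> K))" if p: "CARD('n) + 1 \<le> p" for p
  proof -
    \<comment> \<open>The factor \<open>CARD('n) + 1\<close> accounts for repeated draws
      (\<open>pq_indexed\<close>); \<open>2 * d + 1\<close> is the dimension of the space of pairs
      plus one.\<close>
    obtain R where R: "\<forall>(f :: nat \<Rightarrow> (real^'n) set) H. finite H \<and> R \<le> card H \<and> (\<forall>s\<in>H. convex (f s)) \<and>
     (\<forall>G\<subseteq>H. card G = p * (CARD('n) + 1) \<longrightarrow> (\<exists>J\<subseteq>G. card J = CARD('n) + 1 \<and> 1 \<le> ediam (\<Inter>s\<in>J. f s))) \<longrightarrow>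
     (\<exists>i. \<exists>S\<subseteq>H. card S = 2 * d + 1 \<and>
       (\<exists>x\<in>\<Inter>s\<in>S. f s. \<exists>y\<in>\<Inter>s\<in>S. f s. 1 / (4 * real CARD('n)) \<le> y $ i - x $ i))"
      using Ramsey_extent[where 'n = 'n and p = "p * (CARD('n) + 1)" and N = "2 * d + 1"]
      by (elim exE) (rule that)
    \<comment> \<open>Adding 1 keeps the denominator of \<open>\<beta>\<close> positive even if
      \<open>R\<close> is 0.\<close>
    define P where "P = R + 1"
    define \<beta> where "\<beta> = 1 / real (d * 2 ^ P * P)"
    have "1 \<le> d * 2 ^ P * P" using d by (simp add: P_def Suc_le_eq)
    then have "1 \<le> real (d * 2 ^ P * P)" by (metis of_nat_1 of_nat_le_iff)
    then have \<beta>: "0 < \<beta>" "\<beta> \<le> 1" by (simp_all add: \<beta>_def del: of_nat_mult)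
    \<comment> \<open>\<open>multiplicative_weights\<close> costs the factor 4, the choice of one of
      \<open>d\<close> directions the factor \<open>d\<close>.\<close>
    define \<epsilon> where "\<epsilon> = \<beta> / (4 * d)"
    have eps: "0 < \<epsilon>" using \<beta> d by (simp add: \<epsilon>_def)
    obtain N :: nat where N: "\<forall>(Y::nat set) (z :: nat \<Rightarrow> (real^'n) \<times> (real^'n)). finite Y \<and> Y \<noteq> {} \<longrightarrow>
    (\<exists>A. finite A \<and> card A \<le> N \<and>
      (\<forall>C. convex C \<and> \<epsilon> * card Y \<le> card {t\<in>Y. z t \<in> C} \<longrightarrow> A \<inter> C \<noteq> {}))"
      using weak_epsilon_net[OF eps, where 'a = "(real^'n) \<times> (real^'n)"] by (elim exE) (rule that)
    have "\<exists>C :: (real^'n) set set. finite C \<and> card C \<le> d * N \<and>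
             (\<forall>c\<in>C. convex c \<and> ediam c \<ge> ereal v) \<and> (\<forall>K\<in>F. \<exists>c\<in>C. c \<subseteq> K)"
      if finF: "finite F" and F: "\<And>K. K \<in> F \<Longrightarrow> convex K" "\<And>K. K \<in> F \<Longrightarrow> 1 \<le> ediam K"
        and pq: "\<And>G. G \<subseteq> F \<Longrightarrow> card G = p \<Longrightarrow>
          \<exists>H\<subseteq>G. card H = CARD('n) + 1 \<and> ediam (\<Inter>H) \<ge> 1" for F :: "(real^'n) set set"
    proof -
      have meet: "\<exists>i\<in>UNIV. \<exists>S\<subseteq>{..<P}. card S = DIM((real^'n) \<times> (real^'n)) + 1 \<and> (\<Inter>s\<in>S. L i (f s)) \<noteq> {}"
        if f: "f \<in> {..<P} \<rightarrow>\<^sub>E F" for f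
      proof -
        have fF: "f s \<in> F" if "s < P" for s using f that by (auto dest: PiE_mem)
        have "\<exists>J\<subseteq>G. card J = CARD('n) + 1 \<and> 1 \<le> ediam (\<Inter>s\<in>J. f s)"
          if "G \<subseteq> {..<P}" "card G = p * (CARD('n) + 1)" for G
          using that p fF by (intro pq_indexed[OF _ _ _ F(2) pq]) auto
        then obtain i S x y where S: "S \<subseteq> {..<P}" "card S = 2 * d + 1"
          and "x \<in> (\<Inter>s\<in>S. f s)" "y \<in> (\<Inter>s\<in>S. f s)" "v \<le> y $ i - x $ i"
          using R[rule_format, of "{..<P}" f] fF F(1) unfolding v_def d_def P_def by auto
        then have "(x, y) \<in> (\<Inter>s\<in>S. L i (f s))" by (auto simp: L_def)
        then show ?thesis using S by (intro bexI[of _ i] exI[of _ S]) (auto simp: d_def)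
      qed
      \<comment> \<open>The objects that hit are pairs of a direction and a point, since the
        direction from \<open>fractional_Helly\<close> varies with the weights.\<close>
      have "\<exists>q :: 'n \<times> ((real^'n) \<times> (real^'n)). \<beta> \<le> (\<Sum>K\<in>F. m K * of_bool (snd q \<in> L (fst q) K))"
        if "\<And>K. K \<in> F \<Longrightarrow> 0 \<le> m K" "sum m F = 1" for m
        using fractional_Helly[OF finF finite[of UNIV] that convL[OF F(1)] meet]
        unfolding \<beta>_def d_def by auto
      from multiplicative_weights[OF finF \<beta> this] obtain T and q :: "nat \<Rightarrow> 'n \<times> ((real^'n) \<times> (real^'n))"
        where T: "0 < T" and q: "\<And>K. K \<in> F \<Longrightarrow>
          \<beta> / 4 * real T \<le> card {t\<in>{..<T}. snd (q t) \<in> L (fst (q t)) K}"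
        by blast
      define Y where "Y i = {t\<in>{..<T}. fst (q t) = i}" for i
      have finY: "finite (Y i)" for i by (simp add: Y_def)
      \<comment> \<open>One net per direction. For empty \<open>Y i\<close> the density condition
        would hold for every \<open>C\<close>, even the empty set, hence the guard.\<close>
      define net where "net i A \<longleftrightarrow> finite A \<and> card A \<le> N \<and> (\<forall>C. convex C \<and> Y i \<noteq> {} \<and>
          \<epsilon> * card (Y i) \<le> card {t\<in>Y i. snd (q t) \<in> C} \<longrightarrow> A \<inter> C \<noteq> {})" for i A
      have "\<exists>A. net i A" for i
      proof (cases "Y i = {}")
        case True
        then show ?thesis unfolding net_def by (intro exI[of _ "{}"]) auto
      next
        case False
        then show ?thesis using N[rule_format, of "Y i" "\<lambda>t. snd (q t)"] finY
          unfolding net_def by auto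
      qed
      then obtain A where net: "\<And>i. net i (A i)" by metis
      then have finA: "\<And>i. finite (A i)" and cardA: "\<And>i. card (A i) \<le> N"
        and A: "\<And>i C. convex C \<Longrightarrow> Y i \<noteq> {} \<Longrightarrow>
          \<epsilon> * card (Y i) \<le> card {t\<in>Y i. snd (q t) \<in> C} \<Longrightarrow> A i \<inter> C \<noteq> {}"
        unfolding net_def by blast+
      \<comment> \<open>Net points whose two components are too close are dropped, so that every
        segment in \<open>C\<close> has diameter at least \<open>v\<close>.\<close>
      define B where "B = {(x, y) \<in> (\<Union>i. A i). v \<le> dist x y}"
      define C where "C = (\<lambda>(x, y). closed_segment x y) ` B"
      have finU: "finite (\<Union>i. A i)" using finA by auto
      have finB: "finite B" unfolding B_def using finU by (rule rev_finite_subset) auto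
      have "card B \<le> card (\<Union>i. A i)" unfolding B_def using finU by (intro card_mono) auto
      also have "\<dots> \<le> (\<Sum>i\<in>UNIV. card (A i))" by (rule card_UN_le) auto
      also have "\<dots> \<le> d * N"
        using sum_bounded_above[of UNIV "\<lambda>i. card (A i)" N] cardA by (simp add: d_def)
      finally have cardC: "card C \<le> d * N"
        unfolding C_def using card_image_le[OF finB] by (meson order.trans)
      have "ereal v \<le> ediam (closed_segment x y)" if "v \<le> dist x y" for x y :: "real^'n"
        unfolding ediam_def using that by (intro Sup_upper2[of "ereal (dist x y)"]) auto
      then have C: "convex c \<and> ediam c \<ge> ereal v" if "c \<in> C" for c
        using that by (auto simp: C_def B_def)
      have "\<exists>c\<in>C. c \<subseteq> K" if K: "K \<in> F" for K
      proof -
        define X where "X i = {t\<in>Y i. snd (q t) \<in> L i K}" for i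
        \<comment> \<open>Pigeonhole: some direction receives at least the average share of the hits
          on \<open>K\<close>.\<close>
        have "\<exists>i. \<beta> / (4 * d) * real T \<le> card (X i)"
        proof (rule ccontr)
          assume "\<not> ?thesis"
          then have "(\<Sum>i\<in>UNIV. real (card (X i))) < (\<Sum>i\<in>(UNIV::'n set). \<beta> / (4 * d) * real T)"
            by (intro sum_strict_mono) (auto simp: not_le)
          also have "\<dots> = \<beta> / 4 * real T" using d by (simp add: d_def)
          also have "\<dots> \<le> card {t\<in>{..<T}. snd (q t) \<in> L (fst (q t)) K}" by (rule q[OF K])
          also have "{t\<in>{..<T}. snd (q t) \<in> L (fst (q t)) K} = (\<Union>i. X i)"
            by (auto simp: X_def Y_def)
          also have "real (card (\<Union>i. X i)) \<le> (\<Sum>i\<in>UNIV. real (card (X i)))"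
            using card_UN_le[of UNIV X] by (simp flip: of_nat_sum)
          finally show False by simp
        qed
        then obtain i where i: "\<beta> / (4 * d) * real T \<le> card (X i)" by blast
        have "0 < \<beta> / (4 * d) * real T" using \<beta> d T by simp
        then have "X i \<noteq> {}" using i by auto
        then have "Y i \<noteq> {}" by (auto simp: X_def)
        \<comment> \<open>The hits are a fraction of all \<open>T\<close> rounds, hence at least the
          same fraction of the smaller set \<open>Y i\<close>.\<close>
        moreover have "\<epsilon> * card (Y i) \<le> \<epsilon> * real T"
          using eps card_mono[of "{..<T}" "Y i"] by (intro mult_left_mono) (auto simp: Y_def)
        then have "\<epsilon> * card (Y i) \<le> card {t\<in>Y i. snd (q t) \<in> L i K}"
          using i unfolding \<epsilon>_def X_def by linarith
        ultimately have "A i \<inter> L i K \<noteq> {}" using A convL[OF F(1)[OF K]] by blast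
        then obtain x y where xy: "(x, y) \<in> A i" "x \<in> K" "y \<in> K" "v \<le> y $ i - x $ i"
          by (auto simp: L_def)
        have "y $ i - x $ i \<le> dist x y"
          using component_le_norm_cart[of "y - x" i] by (simp add: dist_norm norm_minus_commute)
        then have "(x, y) \<in> B" using xy by (auto simp: B_def)
        then have "closed_segment x y \<in> C" by (force simp: C_def)
        moreover have "closed_segment x y \<subseteq> K"
          using xy F(1)[OF K] by (simp add: closed_segment_subset)
        ultimately show ?thesis by blast
      qed
      moreover have "finite C" using finB by (simp add: C_def)
      ultimately show ?thesis using cardC C by blast
    qed
    then show ?thesis by (intro exI[of _ "d * N"] allI impI) (elim conjE, blast)
  qed
  then show ?thesis using v by blast
qed

end
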